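(* Let $\mathbf{P}$ be an additive category and let $\overline{\alpha}: (A \xrightarrow{\gamma_A} \Omega_A \xleftarrow{\rho_A} R_A) \to (B \xrightarrow{\gamma_B} \Omega_B \xleftarrow{\rho_B} R_B)$ be a monomorphism in $\mathcal{Q}(\mathbf{P})$. Let $\overline{\tau}: (T \xrightarrow{\gamma_T} \Omega_T \xleftarrow{\rho_T} R_T) \to (B \xrightarrow{\gamma_B} \Omega_B \xleftarrow{\rho_B} R_B)$ be a morphism in $\mathcal{Q}(\mathbf{P})$ whose composite with the cokernel projection $$\overline{\mathrm{id}_B}: (B \xrightarrow{\gamma_B} \Omega_B \xleftarrow{\rho_B} R_B) \to \left(B \xrightarrow{\gamma_B} \Omega_B \xleftarrow{\begin{pmatrix}\rho_B \\ \alpha\cdot\gamma_B\end{pmatrix}} R_B\oplus A\right)$$ of $\overline{\alpha}$ is zero, and let $\begin{pmatrix}\zeta_1 & \zeta_2\end{pmatrix}: T \to R_B \oplus A$ be a witness for this, i.e. $\tau\cdot\gamma_B = \zeta_1\cdot\rho_B + \zeta_2\cdot\alpha\cdot\gamma_B$. Then $\zeta_2: T \to A$ defines a well-defined morphism $\overline{\zeta_2}: (T \xrightarrow{\gamma_T} \Omega_T \xleftarrow{\rho_T} R_T) \to (A \xrightarrow{\gamma_A} \Omega_A \xleftarrow{\rho_A} R_A)$ in $\mathcal{Q}(\mathbf{P})$, and $\overline{\zeta_2}\cdot\overline{\alpha} = \overline{\tau}$. In particular, every monomorphism in $\mathcal{Q}(\mathbf{P})$ is the kernel of its cokernel.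
   Context: Composition is written diagrammatically: for $\alpha: A \to B$ and $\beta: B \to C$, the composite is $\alpha\cdot\beta: A \to C$. Morphisms between direct sums use the row convention: $\begin{pmatrix}\rho_1 \\ \rho_2\end{pmatrix}: X_1\oplus X_2 \to Y$ has components $\rho_i: X_i \to Y$, and $\begin{pmatrix}\zeta_1 & \zeta_2\end{pmatrix}: T \to X_1\oplus X_2$ has components $\zeta_i: T \to X_i$. A cospan in $\mathbf{P}$ is a pair of morphisms $(A \xrightarrow{\gamma} B \xleftarrow{\rho} C)$ with common codomain. $\mathrm{Syz}(A \xrightarrow{\gamma} B \xleftarrow{\rho} C)$ is the full subcategory of the slice category of $\mathbf{P}$ over $A$ whose objects, called syzygies, are the morphisms $\sigma: S \to A$ for which there exists $\omega: S \to C$ (a syzygy witness) with $\sigma\cdot\gamma = \omega\cdot\rho$. The additive category $\mathrm{Aux}(\mathbf{P})$ has as objects the cospans $(A \xrightarrow{\gamma_A} \Omega_A \xleftarrow{\rho_A} R_A)$ in $\mathbf{P}$; a morphism from $(A \xrightarrow{\gamma_A} \Omega_A \xleftarrow{\rho_A} R_A)$ to $(B \xrightarrow{\gamma_B} \Omega_B \xleftarrow{\rho_B} R_B)$ is a morphism $\alpha: A \to B$ in $\mathbf{P}$ satisfying the well-definedness property: $\sigma \in \mathrm{Syz}(A \xrightarrow{\gamma_A} \Omega_A \xleftarrow{\rho_A} R_A)$ implies $\sigma\cdot\alpha \in \mathrm{Syz}(B \xrightarrow{\gamma_B} \Omega_B \xleftarrow{\rho_B} R_B)$; composition and identities are those of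 $\mathbf{P}$. The ideal $\mathbf{I}(\mathbf{P})$ of $\mathrm{Aux}(\mathbf{P})$ consists of the morphisms $\alpha$ (notation as before) for which there exists $\zeta: A \to R_B$ (a witness for being zero) with $\alpha\cdot\gamma_B = \zeta\cdot\rho_B$. $\mathcal{Q}(\mathbf{P}) := \mathrm{Aux}(\mathbf{P})/\mathbf{I}(\mathbf{P})$ is the additive quotient category; the class of a morphism $\alpha$ of $\mathrm{Aux}(\mathbf{P})$ is denoted $\overline{\alpha}$. *)

theory Defs
  imports "HOL-Algebra.Coset"
begin

text \<open>
  Composition is diagrammatic: for \<open>f\<close> from \<open>X\<close> to \<open>Y\<close> and \<open>g\<close> from \<open>Y\<close> to \<open>Z\<close>, the composite
  from \<open>X\<close> to \<open>Z\<close> is \<open>Comp C X Y Z f g\<close>.  Composition, addition and zero carry the objects as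
  arguments and the sets \<open>Hom C X Y\<close> need not be disjoint: one and the same arrow of an additive
  category can represent morphisms between several pairs of cospans.
\<close>

record ('o, 'm) cat =
  Obj :: "'o set"
  Hom :: "'o \<Rightarrow> 'o \<Rightarrow> 'm set"
  Comp :: "'o \<Rightarrow> 'o \<Rightarrow> 'o \<Rightarrow> 'm \<Rightarrow> 'm \<Rightarrow> 'm"
  Ident :: "'o \<Rightarrow> 'm"

record ('o, 'm) preadd_cat = "('o, 'm) cat" +
  Plus :: "'o \<Rightarrow> 'o \<Rightarrow> 'm \<Rightarrow> 'm \<Rightarrow> 'm"
  Null :: "'o \<Rightarrow> 'o \<Rightarrow> 'm"

locale category =
  fixes C :: "('o, 'm, 'z) cat_scheme"
  assumes ident_closed: "X \<in> Obj C \<Longrightarrow> Ident C X \<in> Hom C X X"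
    and comp_closed:
      "\<lbrakk>X \<in> Obj C; Y \<in> Obj C; Z \<in> Obj C; f \<in> Hom C X Y; g \<in> Hom C Y Z\<rbrakk>
        \<Longrightarrow> Comp C X Y Z f g \<in> Hom C X Z"
    and ident_left:
      "\<lbrakk>X \<in> Obj C; Y \<in> Obj C; f \<in> Hom C X Y\<rbrakk> \<Longrightarrow> Comp C X X Y (Ident C X) f = f"
    and ident_right:
      "\<lbrakk>X \<in> Obj C; Y \<in> Obj C; f \<in> Hom C X Y\<rbrakk> \<Longrightarrow> Comp C X Y Y f (Ident C Y) = f"
    and comp_assoc:
      "\<lbrakk>W \<in> Obj C; X \<in> Obj C; Y \<in> Obj C; Z \<in> Obj C;
        f \<in> Hom C W X; g \<in> Hom C X Y; h \<in> Hom C Y Z\<rbrakk>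
        \<Longrightarrow> Comp C W Y Z (Comp C W X Y f g) h = Comp C W X Z f (Comp C X Y Z g h)"

text \<open>The library's groups are written multiplicatively; here the operation is addition of morphisms.\<close>

definition hom_group :: "('o, 'm, 'z) preadd_cat_scheme \<Rightarrow> 'o \<Rightarrow> 'o \<Rightarrow> 'm monoid" where
  "hom_group C X Y = \<lparr>carrier = Hom C X Y, monoid.mult = Plus C X Y, one = Null C X Y\<rparr>"

locale preadditive_category = category C
  for C :: "('o, 'm, 'z) preadd_cat_scheme" +
  assumes hom_comm_group: "\<lbrakk>X \<in> Obj C; Y \<in> Obj C\<rbrakk> \<Longrightarrow> comm_group (hom_group C X Y)"
    and comp_plus_left:
      "\<lbrakk>X \<in> Obj C; Y \<in> Obj C; Z \<in> Obj C; f \<in> Hom C X Y; f' \<in> Hom C X Y; g \<in> Hom C Y Z\<rbrakk>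
        \<Longrightarrow> Comp C X Y Z (Plus C X Y f f') g = Plus C X Z (Comp C X Y Z f g) (Comp C X Y Z f' g)"
    and comp_plus_right:
      "\<lbrakk>X \<in> Obj C; Y \<in> Obj C; Z \<in> Obj C; f \<in> Hom C X Y; g \<in> Hom C Y Z; g' \<in> Hom C Y Z\<rbrakk>
        \<Longrightarrow> Comp C X Y Z f (Plus C Y Z g g') = Plus C X Z (Comp C X Y Z f g) (Comp C X Y Z f g')"

definition is_zero_object :: "('o, 'm, 'z) cat_scheme \<Rightarrow> 'o \<Rightarrow> bool" where
  "is_zero_object C Z \<longleftrightarrow>
    Z \<in> Obj C \<and> (\<forall>X\<in>Obj C. (\<exists>!f. f \<in> Hom C Z X) \<and> (\<exists>!f. f \<in> Hom C X Z))"

record ('o, 'm) direct_sum =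
  dsum :: 'o
  inj1 :: 'm
  inj2 :: 'm
  prj1 :: 'm
  prj2 :: 'm

definition is_direct_sum ::
  "('o, 'm, 'z) preadd_cat_scheme \<Rightarrow> 'o \<Rightarrow> 'o \<Rightarrow> ('o, 'm) direct_sum \<Rightarrow> bool" where
  "is_direct_sum C X1 X2 D \<longleftrightarrow>
    X1 \<in> Obj C \<and> X2 \<in> Obj C \<and> dsum D \<in> Obj C \<and>
    inj1 D \<in> Hom C X1 (dsum D) \<and> inj2 D \<in> Hom C X2 (dsum D) \<and>
    prj1 D \<in> Hom C (dsum D) X1 \<and> prj2 D \<in> Hom C (dsum D) X2 \<and>
    Comp C X1 (dsum D) X1 (inj1 D) (prj1 D) = Ident C X1 \<and>
    Comp C X2 (dsum D) X2 (inj2 D) (prj2 D) = Ident C X2 \<and>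
    Comp C X1 (dsum D) X2 (inj1 D) (prj2 D) = Null C X1 X2 \<and>
    Comp C X2 (dsum D) X1 (inj2 D) (prj1 D) = Null C X2 X1 \<and>
    Plus C (dsum D) (dsum D)
      (Comp C (dsum D) X1 (dsum D) (prj1 D) (inj1 D))
      (Comp C (dsum D) X2 (dsum D) (prj2 D) (inj2 D)) = Ident C (dsum D)"

locale additive_category = preadditive_category C
  for C :: "('o, 'm, 'z) preadd_cat_scheme" +
  assumes ex_zero_object: "\<exists>Z. is_zero_object C Z"
    and ex_direct_sum: "\<lbrakk>X1 \<in> Obj C; X2 \<in> Obj C\<rbrakk> \<Longrightarrow> \<exists>D. is_direct_sum C X1 X2 D"

text \<open>
  Row convention: \<open>from_sum C X1 X2 D Y r1 r2\<close> is the morphism from the direct sum to \<open>Y\<close> with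
  components \<open>r1\<close> and \<open>r2\<close> (written as a column), and \<open>to_sum C X1 X2 D T z1 z2\<close> is the morphism
  from \<open>T\<close> to the direct sum with components \<open>z1\<close> and \<open>z2\<close> (written as a row).
\<close>

definition from_sum ::
  "('o, 'm, 'z) preadd_cat_scheme \<Rightarrow> 'o \<Rightarrow> 'o \<Rightarrow> ('o, 'm) direct_sum \<Rightarrow> 'o \<Rightarrow> 'm \<Rightarrow> 'm \<Rightarrow> 'm" where
  "from_sum C X1 X2 D Y r1 r2 =
    Plus C (dsum D) Y (Comp C (dsum D) X1 Y (prj1 D) r1) (Comp C (dsum D) X2 Y (prj2 D) r2)"

definition to_sum ::
  "('o, 'm, 'z) preadd_cat_scheme \<Rightarrow> 'o \<Rightarrow> 'o \<Rightarrow> ('o, 'm) direct_sum \<Rightarrow> 'o \<Rightarrow> 'm \<Rightarrow> 'm \<Rightarrow> 'm" where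
  "to_sum C X1 X2 D T z1 z2 =
    Plus C T (dsum D) (Comp C T X1 (dsum D) z1 (inj1 D)) (Comp C T X2 (dsum D) z2 (inj2 D))"

definition is_mono :: "('o, 'm, 'z) cat_scheme \<Rightarrow> 'o \<Rightarrow> 'o \<Rightarrow> 'm \<Rightarrow> bool" where
  "is_mono C X Y f \<longleftrightarrow>
    X \<in> Obj C \<and> Y \<in> Obj C \<and> f \<in> Hom C X Y \<and>
    (\<forall>W\<in>Obj C. \<forall>g\<in>Hom C W X. \<forall>h\<in>Hom C W X. Comp C W X Y g f = Comp C W X Y h f \<longrightarrow> g = h)"

definition is_kernel ::
  "('o, 'm, 'z) preadd_cat_scheme \<Rightarrow> 'o \<Rightarrow> 'o \<Rightarrow> 'm \<Rightarrow> 'o \<Rightarrow> 'm \<Rightarrow> bool" where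
  \<comment> \<open>\<open>k\<close> from \<open>K\<close> to \<open>X\<close> is a kernel of \<open>f\<close> from \<open>X\<close> to \<open>Y\<close>\<close>
  "is_kernel C X Y f K k \<longleftrightarrow>
    X \<in> Obj C \<and> Y \<in> Obj C \<and> K \<in> Obj C \<and> f \<in> Hom C X Y \<and> k \<in> Hom C K X \<and>
    Comp C K X Y k f = Null C K Y \<and>
    (\<forall>T\<in>Obj C. \<forall>t\<in>Hom C T X. Comp C T X Y t f = Null C T Y \<longrightarrow>
      (\<exists>!u. u \<in> Hom C T K \<and> Comp C T K X u k = t))"

definition is_cokernel ::
  "('o, 'm, 'z) preadd_cat_scheme \<Rightarrow> 'o \<Rightarrow> 'o \<Rightarrow> 'm \<Rightarrow> 'o \<Rightarrow> 'm \<Rightarrow> bool" where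
  \<comment> \<open>\<open>c\<close> from \<open>Y\<close> to \<open>K\<close> is a cokernel of \<open>f\<close> from \<open>X\<close> to \<open>Y\<close>\<close>
  "is_cokernel C X Y f K c \<longleftrightarrow>
    X \<in> Obj C \<and> Y \<in> Obj C \<and> K \<in> Obj C \<and> f \<in> Hom C X Y \<and> c \<in> Hom C Y K \<and>
    Comp C X Y K f c = Null C X K \<and>
    (\<forall>T\<in>Obj C. \<forall>t\<in>Hom C Y T. Comp C X Y T f t = Null C X T \<longrightarrow>
      (\<exists>!u. u \<in> Hom C K T \<and> Comp C Y K T c u = t))"

text \<open>
  The quotient of a preadditive category by an ideal \<open>I\<close>: the morphisms are the cosets of the
  subgroups \<open>I X Y\<close>.  The composite of two classes is the union of the classes of all composites of
  representatives; these all coincide because \<open>I\<close> is an ideal.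
\<close>

definition mor_class ::
  "('o, 'm, 'z) preadd_cat_scheme \<Rightarrow> ('o \<Rightarrow> 'o \<Rightarrow> 'm set) \<Rightarrow> 'o \<Rightarrow> 'o \<Rightarrow> 'm \<Rightarrow> 'm set" where
  "mor_class C I X Y f = I X Y #>\<^bsub>hom_group C X Y\<^esub> f"

definition quotient_cat ::
  "('o, 'm, 'z) preadd_cat_scheme \<Rightarrow> ('o \<Rightarrow> 'o \<Rightarrow> 'm set) \<Rightarrow> ('o, 'm set) preadd_cat" where
  "quotient_cat C I =
    \<lparr>Obj = Obj C,
     Hom = (\<lambda>X Y. rcosets\<^bsub>hom_group C X Y\<^esub> (I X Y)),
     Comp = (\<lambda>X Y Z F G. \<Union>f\<in>F. \<Union>g\<in>G. mor_class C I X Z (Comp C X Y Z f g)),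
     Ident = (\<lambda>X. mor_class C I X X (Ident C X)),
     Plus = (\<lambda>X Y F G. F <#>\<^bsub>hom_group C X Y\<^esub> G),
     Null = (\<lambda>X Y. I X Y)\<rparr>"

text \<open>A cospan, with legs \<open>cgam\<close> from \<open>cobj\<close> to \<open>capex\<close> and \<open>crho\<close> from \<open>crel\<close> to \<open>capex\<close>.\<close>

record ('o, 'm) cospan =
  cobj :: 'o
  capex :: 'o
  crel :: 'o
  cgam :: 'm
  crho :: 'm

definition is_cospan :: "('o, 'm, 'z) cat_scheme \<Rightarrow> ('o, 'm) cospan \<Rightarrow> bool" where
  "is_cospan P X \<longleftrightarrow>
    cobj X \<in> Obj P \<and> capex X \<in> Obj P \<and> crel X \<in> Obj P \<and>
    cgam X \<in> Hom P (cobj X) (capex X) \<and> crho X \<in> Hom P (crel X) (capex X)"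

text \<open>The objects of the category of syzygies; a morphism is given together with its domain.\<close>

definition Syz :: "('o, 'm, 'z) cat_scheme \<Rightarrow> ('o, 'm) cospan \<Rightarrow> ('o \<times> 'm) set" where
  "Syz P X = {(S, \<sigma>). S \<in> Obj P \<and> \<sigma> \<in> Hom P S (cobj X) \<and>
    (\<exists>\<omega>\<in>Hom P S (crel X).
      Comp P S (cobj X) (capex X) \<sigma> (cgam X) = Comp P S (crel X) (capex X) \<omega> (crho X))}"

definition aux_cat ::
  "('o, 'm, 'z) preadd_cat_scheme \<Rightarrow> (('o, 'm) cospan, 'm) preadd_cat" where
  "aux_cat P =
    \<lparr>Obj = {X. is_cospan P X},
     Hom = (\<lambda>X Y. {\<alpha> \<in> Hom P (cobj X) (cobj Y).
       \<forall>S \<sigma>. (S, \<sigma>) \<in> Syz P X \<longrightarrow> (S, Comp P S (cobj X) (cobj Y) \<sigma> \<alpha>) \<in> Syz P Y}),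
     Comp = (\<lambda>X Y Z. Comp P (cobj X) (cobj Y) (cobj Z)),
     Ident = (\<lambda>X. Ident P (cobj X)),
     Plus = (\<lambda>X Y. Plus P (cobj X) (cobj Y)),
     Null = (\<lambda>X Y. Null P (cobj X) (cobj Y))\<rparr>"

definition zero_witness ::
  "('o, 'm, 'z) cat_scheme \<Rightarrow> ('o, 'm) cospan \<Rightarrow> ('o, 'm) cospan \<Rightarrow> 'm \<Rightarrow> 'm \<Rightarrow> bool" where
  "zero_witness P X Y \<alpha> \<zeta> \<longleftrightarrow>
    \<zeta> \<in> Hom P (cobj X) (crel Y) \<and>
    Comp P (cobj X) (cobj Y) (capex Y) \<alpha> (cgam Y) = Comp P (cobj X) (crel Y) (capex Y) \<zeta> (crho Y)"

definition zero_ideal ::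
  "('o, 'm, 'z) preadd_cat_scheme \<Rightarrow> ('o, 'm) cospan \<Rightarrow> ('o, 'm) cospan \<Rightarrow> 'm set" where
  "zero_ideal P X Y = {\<alpha> \<in> Hom (aux_cat P) X Y. \<exists>\<zeta>. zero_witness P X Y \<alpha> \<zeta>}"

definition Q_cat ::
  "('o, 'm, 'z) preadd_cat_scheme \<Rightarrow> (('o, 'm) cospan, 'm set) preadd_cat" where
  "Q_cat P = quotient_cat (aux_cat P) (zero_ideal P)"

definition Q_class ::
  "('o, 'm, 'z) preadd_cat_scheme \<Rightarrow> ('o, 'm) cospan \<Rightarrow> ('o, 'm) cospan \<Rightarrow> 'm \<Rightarrow> 'm set" where
  "Q_class P X Y \<alpha> = mor_class (aux_cat P) (zero_ideal P) X Y \<alpha>"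

text \<open>
  The target of the cokernel projection of the class of \<open>\<alpha>\<close> from \<open>A\<close> to \<open>B\<close>, for a direct sum
  \<open>D\<close> of \<open>crel B\<close> and \<open>cobj A\<close>.
\<close>

definition coker_cospan ::
  "('o, 'm, 'z) preadd_cat_scheme \<Rightarrow> ('o, 'm) cospan \<Rightarrow> ('o, 'm) cospan \<Rightarrow> 'm
    \<Rightarrow> ('o, 'm) direct_sum \<Rightarrow> ('o, 'm) cospan" where
  "coker_cospan P A B \<alpha> D =
    \<lparr>cobj = cobj B, capex = capex B, crel = dsum D, cgam = cgam B,
     crho = from_sum P (crel B) (cobj A) D (capex B)
       (crho B) (Comp P (cobj A) (cobj B) (capex B) \<alpha> (cgam B))\<rparr>"

end

theory Submission
  imports Defs
begin

text \<open>
  Write \<open>\<alpha> \<in> Syz B\<close> when \<open>\<alpha> \<cdot> \<gamma>\<^sub>B\<close> factors through \<open>\<rho>\<^sub>B\<close>. Then the class of \<open>\<alpha>\<close> into \<open>B\<close> vanishes iff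
  \<open>\<alpha> \<in> Syz B\<close>, and if it is a monomorphism from \<open>A\<close>, then \<open>\<sigma> \<cdot> \<alpha> \<in> Syz B\<close> implies \<open>\<sigma> \<in> Syz A\<close>. For the
  cokernel object \<open>K\<close> one has \<open>\<sigma> \<in> Syz K\<close> iff \<open>\<sigma> - \<omega> \<cdot> \<alpha> \<in> Syz B\<close> for some \<open>\<omega>\<close> into \<open>A\<close>; this
  yields the universal property of \<open>K\<close>. If \<open>\<tau>\<close> is killed by the projection, it also yields \<open>\<zeta>\<close> with
  \<open>\<tau> - \<zeta> \<cdot> \<alpha> \<in> Syz B\<close>. For \<open>\<sigma> \<in> Syz T\<close>, \<open>\<sigma> \<cdot> \<tau>\<close> and hence \<open>\<sigma> \<cdot> \<zeta> \<cdot> \<alpha>\<close> is in \<open>Syz B\<close>, so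
  \<open>\<sigma> \<cdot> \<zeta> \<in> Syz A\<close>, i.e. \<open>\<zeta>\<close> is well defined.
\<close>

section \<open>Preadditive categories\<close>

text \<open>The record has no field for negatives. Giving the group inverse the same object
  arguments as \<open>Plus\<close> lets differences be handled without
  \<open>hom_group\<close>.\<close>

definition Neg :: "('o, 'm, 'z) preadd_cat_scheme \<Rightarrow> 'o \<Rightarrow> 'o \<Rightarrow> 'm \<Rightarrow> 'm" where
  "Neg C X Y f = inv\<^bsub>hom_group C X Y\<^esub> f"

lemma hom_group_sel [simp]:
  "carrier (hom_group C X Y) = Hom C X Y"
  "monoid.mult (hom_group C X Y) = Plus C X Y"
  "one (hom_group C X Y) = Null C X Y"
  by (simp_all add: hom_group_def)

context preadditive_category
begin

lemmas [simp] = ident_closed comp_closed ident_left ident_right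

context
  fixes X Y
  assumes objs: "X \<in> Obj C" "Y \<in> Obj C"
begin

interpretation hom: comm_group "hom_group C X Y"
  using hom_comm_group objs .

lemma plus_closed [simp]: "f \<in> Hom C X Y \<Longrightarrow> g \<in> Hom C X Y \<Longrightarrow> Plus C X Y f g \<in> Hom C X Y"
  using hom.m_closed by simp

lemma null_closed [simp]: "Null C X Y \<in> Hom C X Y"
  using hom.one_closed by simp

lemma neg_closed [simp]: "f \<in> Hom C X Y \<Longrightarrow> Neg C X Y f \<in> Hom C X Y"
  using hom.inv_closed by (simp add: Neg_def)

lemma plus_assoc:
  "f \<in> Hom C X Y \<Longrightarrow> g \<in> Hom C X Y \<Longrightarrow> h \<in> Hom C X Y
    \<Longrightarrow> Plus C X Y (Plus C X Y f g) h = Plus C X Y f (Plus C X Y g h)"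
  using hom.m_assoc by simp

lemma plus_commute: "f \<in> Hom C X Y \<Longrightarrow> g \<in> Hom C X Y \<Longrightarrow> Plus C X Y f g = Plus C X Y g f"
  using hom.m_comm by simp

lemma plus_null [simp]:
  "f \<in> Hom C X Y \<Longrightarrow> Plus C X Y f (Null C X Y) = f"
  "f \<in> Hom C X Y \<Longrightarrow> Plus C X Y (Null C X Y) f = f"
  using hom.r_one hom.l_one by simp_all

lemma plus_neg [simp]:
  "f \<in> Hom C X Y \<Longrightarrow> Plus C X Y f (Neg C X Y f) = Null C X Y"
  "f \<in> Hom C X Y \<Longrightarrow> Plus C X Y (Neg C X Y f) f = Null C X Y"
  using hom.r_inv hom.l_inv by (simp_all add: Neg_def)

lemma neg_null [simp]: "Neg C X Y (Null C X Y) = Null C X Y"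
  using hom.inv_one by (simp add: Neg_def)

text \<open>Turns a claim about a negative into a vanishing sum, so that bilinearity gives the sign
  rules for composition.\<close>

lemma eq_neg_iff:
  "f \<in> Hom C X Y \<Longrightarrow> g \<in> Hom C X Y \<Longrightarrow> f = Neg C X Y g \<longleftrightarrow> Plus C X Y f g = Null C X Y"
  using hom.inv_equality[of f g] hom.l_inv[of g] by (auto simp: Neg_def)

lemma null_eqI: "f \<in> Hom C X Y \<Longrightarrow> Plus C X Y f f = f \<Longrightarrow> f = Null C X Y"
  using hom.l_cancel_one[of f f] by simp

lemma diff_plus_cancel:
  "f \<in> Hom C X Y \<Longrightarrow> g \<in> Hom C X Y \<Longrightarrow> Plus C X Y (Plus C X Y f (Neg C X Y g)) g = f"
  by (simp add: plus_assoc)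

lemma plus_diff_cancel:
  "f \<in> Hom C X Y \<Longrightarrow> g \<in> Hom C X Y \<Longrightarrow> Plus C X Y (Plus C X Y f g) (Neg C X Y g) = f"
  by (simp add: plus_assoc)

lemma neg_diff:
  "f \<in> Hom C X Y \<Longrightarrow> g \<in> Hom C X Y
    \<Longrightarrow> Neg C X Y (Plus C X Y f (Neg C X Y g)) = Plus C X Y g (Neg C X Y f)"
  using hom.inv_mult_group[of f "inv\<^bsub>hom_group C X Y\<^esub> g"] neg_closed[of g]
  by (simp add: Neg_def)

end

text \<open>Bilinearity makes the composite equal to twice itself, and in a group only zero has this
  property.\<close>

lemma comp_null_right [simp]:
  assumes "X \<in> Obj C" "Y \<in> Obj C" "Z \<in> Obj C" "f \<in> Hom C X Y"
  shows "Comp C X Y Z f (Null C Y Z) = Null C X Z"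
  using assms comp_plus_right[of X Y Z f "Null C Y Z" "Null C Y Z"] by (intro null_eqI) auto

lemma comp_null_left [simp]:
  assumes "X \<in> Obj C" "Y \<in> Obj C" "Z \<in> Obj C" "g \<in> Hom C Y Z"
  shows "Comp C X Y Z (Null C X Y) g = Null C X Z"
  using assms comp_plus_left[of X Y Z "Null C X Y" "Null C X Y" g] by (intro null_eqI) auto

lemma comp_neg_right:
  assumes "X \<in> Obj C" "Y \<in> Obj C" "Z \<in> Obj C" "f \<in> Hom C X Y" "g \<in> Hom C Y Z"
  shows "Comp C X Y Z f (Neg C Y Z g) = Neg C X Z (Comp C X Y Z f g)"
  using assms by (simp add: eq_neg_iff flip: comp_plus_right)

lemma comp_neg_left:
  assumes "X \<in> Obj C" "Y \<in> Obj C" "Z \<in> Obj C" "f \<in> Hom C X Y" "g \<in> Hom C Y Z"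
  shows "Comp C X Y Z (Neg C X Y f) g = Neg C X Z (Comp C X Y Z f g)"
  using assms by (simp add: eq_neg_iff flip: comp_plus_left)

end

section \<open>Quotients by ideals\<close>

text \<open>Quotients are treated for an arbitrary two-sided ideal; \<open>aux_ideal\<close>
  supplies the instance behind \<open>Q_cat\<close>.\<close>

locale preadditive_ideal = preadditive_category C
  for C :: "('o, 'm, 'z) preadd_cat_scheme" +
  fixes I :: "'o \<Rightarrow> 'o \<Rightarrow> 'm set"
  assumes ideal_subgroup: "\<lbrakk>X \<in> Obj C; Y \<in> Obj C\<rbrakk> \<Longrightarrow> subgroup (I X Y) (hom_group C X Y)"
    and ideal_comp_right:
      "\<lbrakk>X \<in> Obj C; Y \<in> Obj C; Z \<in> Obj C; f \<in> I X Y; g \<in> Hom C Y Z\<rbrakk> \<Longrightarrow> Comp C X Y Z f g \<in> I X Z"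
    and ideal_comp_left:
      "\<lbrakk>X \<in> Obj C; Y \<in> Obj C; Z \<in> Obj C; f \<in> Hom C X Y; g \<in> I Y Z\<rbrakk> \<Longrightarrow> Comp C X Y Z f g \<in> I X Z"
begin

lemma Obj_quotient [simp]: "Obj (quotient_cat C I) = Obj C"
  by (simp add: quotient_cat_def)

lemma Null_quotient [simp]: "Null (quotient_cat C I) X Y = I X Y"
  by (simp add: quotient_cat_def)

lemma Ident_quotient: "Ident (quotient_cat C I) X = mor_class C I X X (Ident C X)"
  by (simp add: quotient_cat_def)

lemma Hom_quotient: "Hom (quotient_cat C I) X Y = mor_class C I X Y ` Hom C X Y"
  by (auto simp: quotient_cat_def RCOSETS_def mor_class_def)

context
  fixes X Y
  assumes objs: "X \<in> Obj C" "Y \<in> Obj C"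
begin

interpretation hom: comm_group "hom_group C X Y"
  using hom_comm_group objs .

lemma ideal_subset: "f \<in> I X Y \<Longrightarrow> f \<in> Hom C X Y"
  using subgroup.subset[OF ideal_subgroup[OF objs]] by auto

lemma mem_mor_class_self: "f \<in> Hom C X Y \<Longrightarrow> f \<in> mor_class C I X Y f"
  using hom.rcos_self[OF _ ideal_subgroup[OF objs]] by (simp add: mor_class_def)

lemma mem_mor_class_iff:
  "f \<in> Hom C X Y
    \<Longrightarrow> g \<in> mor_class C I X Y f \<longleftrightarrow> g \<in> Hom C X Y \<and> Plus C X Y g (Neg C X Y f) \<in> I X Y"
  using subgroup.rcos_module[OF ideal_subgroup[OF objs] hom.is_group, of f g]
    subgroup.elemrcos_carrier[OF ideal_subgroup[OF objs] hom.is_group, of f g]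
  by (auto simp: mor_class_def Neg_def)

lemma mor_class_eq_iff:
  assumes "f \<in> Hom C X Y" "g \<in> Hom C X Y"
  shows "mor_class C I X Y f = mor_class C I X Y g \<longleftrightarrow> Plus C X Y f (Neg C X Y g) \<in> I X Y"
proof
  assume "mor_class C I X Y f = mor_class C I X Y g"
  then show "Plus C X Y f (Neg C X Y g) \<in> I X Y"
    using assms mem_mor_class_self mem_mor_class_iff by blast
next
  assume "Plus C X Y f (Neg C X Y g) \<in> I X Y"
  then have "f \<in> mor_class C I X Y g" using assms mem_mor_class_iff by blast
  then show "mor_class C I X Y f = mor_class C I X Y g"
    using hom.repr_independence[OF _ _ ideal_subgroup[OF objs]] assms
    by (simp add: mor_class_def)
qed

lemma mor_class_null [simp]: "mor_class C I X Y (Null C X Y) = I X Y"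
  using hom.coset_mult_one[of "I X Y"] ideal_subset by (auto simp: mor_class_def)

lemma mor_class_eq_ideal_iff:
  "f \<in> Hom C X Y \<Longrightarrow> mor_class C I X Y f = I X Y \<longleftrightarrow> f \<in> I X Y"
  using mor_class_eq_iff[of f "Null C X Y"] objs by simp

end

text \<open>The composite is a union over all representatives, so all classes in that union must
  agree: \<open>f'\<close> is exchanged for \<open>f\<close> by the right ideal law, then
  \<open>g'\<close> for \<open>g\<close> by the left one.\<close>

lemma comp_mor_class:
  assumes "X \<in> Obj C" "Y \<in> Obj C" "Z \<in> Obj C" "f \<in> Hom C X Y" "g \<in> Hom C Y Z"
  shows "Comp (quotient_cat C I) X Y Z (mor_class C I X Y f) (mor_class C I Y Z g)
    = mor_class C I X Z (Comp C X Y Z f g)"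
proof -
  have "mor_class C I X Z (Comp C X Y Z f' g') = mor_class C I X Z (Comp C X Y Z f g)"
    if mem: "f' \<in> mor_class C I X Y f" "g' \<in> mor_class C I Y Z g" for f' g'
  proof -
    from mem have f': "f' \<in> Hom C X Y" "Plus C X Y f' (Neg C X Y f) \<in> I X Y"
      and g': "g' \<in> Hom C Y Z" "Plus C Y Z g' (Neg C Y Z g) \<in> I Y Z"
      using assms mem_mor_class_iff by blast+
    have "Comp C X Y Z (Plus C X Y f' (Neg C X Y f)) g' \<in> I X Z"
      using f' g'(1) assms ideal_comp_right by blast
    then have 1: "mor_class C I X Z (Comp C X Y Z f' g') = mor_class C I X Z (Comp C X Y Z f g')"
      using f'(1) g'(1) assms by (simp add: mor_class_eq_iff comp_plus_left comp_neg_left)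
    have "Comp C X Y Z f (Plus C Y Z g' (Neg C Y Z g)) \<in> I X Z"
      using g' assms ideal_comp_left by blast
    then have "mor_class C I X Z (Comp C X Y Z f g') = mor_class C I X Z (Comp C X Y Z f g)"
      using g'(1) assms by (simp add: mor_class_eq_iff comp_plus_right comp_neg_right)
    with 1 show ?thesis by simp
  qed
  \<comment> \<open>Both index sets are nonempty, so the union of equal classes is that class and
    not the empty set.\<close>
  moreover have "f \<in> mor_class C I X Y f" "g \<in> mor_class C I Y Z g"
    using assms mem_mor_class_self by auto
  ultimately have "(\<Union>f'\<in>mor_class C I X Y f. \<Union>g'\<in>mor_class C I Y Z g.
      mor_class C I X Z (Comp C X Y Z f' g')) = mor_class C I X Z (Comp C X Y Z f g)"
    by blast
  then show ?thesis
    by (simp add: quotient_cat_def)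
qed

lemma quotient_category: "category (quotient_cat C I)"
  by unfold_locales
    (auto simp: Hom_quotient Ident_quotient comp_mor_class comp_assoc)

lemma quotient_comp_null_left:
  assumes "X \<in> Obj C" "Y \<in> Obj C" "Z \<in> Obj C" "G \<in> Hom (quotient_cat C I) Y Z"
  shows "Comp (quotient_cat C I) X Y Z (I X Y) G = I X Z"
  using assms comp_mor_class[of X Y Z "Null C X Y"] by (auto simp: Hom_quotient)

text \<open>Only one cokernel has to be inspected, since its projection factors through that of any other.\<close>

lemma mono_is_kernel_of_cokernel:
  assumes mono: "is_mono (quotient_cat C I) X Y f"
    and coker: "is_cokernel (quotient_cat C I) X Y f K k"
    and lift: "\<And>T t. \<lbrakk>T \<in> Obj C; t \<in> Hom (quotient_cat C I) T Y;
        Comp (quotient_cat C I) T Y K t k = I T K\<rbrakk>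
      \<Longrightarrow> \<exists>u\<in>Hom (quotient_cat C I) T X. Comp (quotient_cat C I) T X Y u f = t"
    and coker': "is_cokernel (quotient_cat C I) X Y f Z c"
  shows "is_kernel (quotient_cat C I) Y Z c X f"
proof -
  interpret Q: category "quotient_cat C I" by (rule quotient_category)
  let ?Q = "quotient_cat C I"
  have objs: "X \<in> Obj C" "Y \<in> Obj C" "Z \<in> Obj C" "K \<in> Obj C"
    and mors: "f \<in> Hom ?Q X Y" "c \<in> Hom ?Q Y Z" "k \<in> Hom ?Q Y K"
    and zero: "Comp ?Q X Y Z f c = I X Z" "Comp ?Q X Y K f k = I X K"
    using coker coker' by (auto simp: is_cokernel_def)
  obtain u where u: "u \<in> Hom ?Q Z K" "Comp ?Q Y Z K c u = k"
    using coker' objs mors zero unfolding is_cokernel_def by (metis Null_quotient Obj_quotient)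
  have "\<exists>!v. v \<in> Hom ?Q T X \<and> Comp ?Q T X Y v f = t"
    if T: "T \<in> Obj C" "t \<in> Hom ?Q T Y" "Comp ?Q T Y Z t c = I T Z" for T t
  proof -
    \<comment> \<open>Whatever \<open>c\<close> kills is also killed by \<open>k\<close>, hence
      \<open>lift\<close> applies. Uniqueness of the lift will come from cancelling the
      monomorphism.\<close>
    have "Comp ?Q T Y K t k = Comp ?Q T Z K (Comp ?Q T Y Z t c) u"
      using Q.comp_assoc[of T Y Z K t c u] T objs mors u by simp
    also have "\<dots> = I T K"
      using T objs u by (simp add: quotient_comp_null_left)
    finally have "\<exists>v\<in>Hom ?Q T X. Comp ?Q T X Y v f = t"
      using lift T by blast
    then show ?thesis
      using mono T unfolding is_mono_def by (metis Obj_quotient)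
  qed
  then show ?thesis
    using objs mors zero by (simp add: is_kernel_def)
qed

end

section \<open>Syzygies\<close>

lemma aux_cat_sel [simp]:
  "Obj (aux_cat P) = {X. is_cospan P X}"
  "Comp (aux_cat P) X Y Z = Comp P (cobj X) (cobj Y) (cobj Z)"
  "Ident (aux_cat P) X = Ident P (cobj X)"
  "Plus (aux_cat P) X Y = Plus P (cobj X) (cobj Y)"
  "Null (aux_cat P) X Y = Null P (cobj X) (cobj Y)"
  by (simp_all add: aux_cat_def)

lemma Hom_aux_cat_iff:
  "\<alpha> \<in> Hom (aux_cat P) X Y \<longleftrightarrow> \<alpha> \<in> Hom P (cobj X) (cobj Y) \<and>
    (\<forall>S \<sigma>. (S, \<sigma>) \<in> Syz P X \<longrightarrow> (S, Comp P S (cobj X) (cobj Y) \<sigma> \<alpha>) \<in> Syz P Y)"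
  by (simp add: aux_cat_def)

lemma Hom_aux_catD:
  assumes "\<alpha> \<in> Hom (aux_cat P) X Y"
  shows "\<alpha> \<in> Hom P (cobj X) (cobj Y)"
    and "(S, \<sigma>) \<in> Syz P X \<Longrightarrow> (S, Comp P S (cobj X) (cobj Y) \<sigma> \<alpha>) \<in> Syz P Y"
  using assms by (auto simp: Hom_aux_cat_iff)

lemma is_cospanD [simp]:
  assumes "is_cospan P X"
  shows "cobj X \<in> Obj P" "capex X \<in> Obj P" "crel X \<in> Obj P"
    "cgam X \<in> Hom P (cobj X) (capex X)" "crho X \<in> Hom P (crel X) (capex X)"
  using assms by (auto simp: is_cospan_def)

lemma SyzI:
  "\<lbrakk>S \<in> Obj P; \<sigma> \<in> Hom P S (cobj X); \<omega> \<in> Hom P S (crel X);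
    Comp P S (cobj X) (capex X) \<sigma> (cgam X) = Comp P S (crel X) (capex X) \<omega> (crho X)\<rbrakk>
    \<Longrightarrow> (S, \<sigma>) \<in> Syz P X"
  by (auto simp: Syz_def)

lemma SyzD: "(S, \<sigma>) \<in> Syz P X \<Longrightarrow> S \<in> Obj P" "(S, \<sigma>) \<in> Syz P X \<Longrightarrow> \<sigma> \<in> Hom P S (cobj X)"
  by (auto simp: Syz_def)

lemma SyzE:
  assumes "(S, \<sigma>) \<in> Syz P X"
  obtains \<omega> where "\<omega> \<in> Hom P S (crel X)"
    "Comp P S (cobj X) (capex X) \<sigma> (cgam X) = Comp P S (crel X) (capex X) \<omega> (crho X)"
  using assms by (auto simp: Syz_def)

section \<open>Closure properties of syzygies and the ideal of zero morphisms\<close>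

context preadditive_category
begin

context
  fixes X
  assumes X: "is_cospan C X"
begin

lemma Syz_null: "S \<in> Obj C \<Longrightarrow> (S, Null C S (cobj X)) \<in> Syz C X"
  using X by (intro SyzI[where \<omega> = "Null C S (crel X)"]) auto

lemma Syz_plus:
  assumes "(S, \<sigma>) \<in> Syz C X" "(S, \<sigma>') \<in> Syz C X"
  shows "(S, Plus C S (cobj X) \<sigma> \<sigma>') \<in> Syz C X"
proof -
  obtain \<omega> \<omega>' where "\<omega> \<in> Hom C S (crel X)" "\<omega>' \<in> Hom C S (crel X)"
    "Comp C S (cobj X) (capex X) \<sigma> (cgam X) = Comp C S (crel X) (capex X) \<omega> (crho X)"
    "Comp C S (cobj X) (capex X) \<sigma>' (cgam X) = Comp C S (crel X) (capex X) \<omega>' (crho X)"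
    using assms by (meson SyzE)
  then show ?thesis
    using assms[THEN SyzD(1)] assms[THEN SyzD(2)] X
    by (intro SyzI[where \<omega> = "Plus C S (crel X) \<omega> \<omega>'"]) (auto simp: comp_plus_left)
qed

lemma Syz_neg:
  assumes "(S, \<sigma>) \<in> Syz C X"
  shows "(S, Neg C S (cobj X) \<sigma>) \<in> Syz C X"
proof -
  obtain \<omega> where "\<omega> \<in> Hom C S (crel X)"
    "Comp C S (cobj X) (capex X) \<sigma> (cgam X) = Comp C S (crel X) (capex X) \<omega> (crho X)"
    using assms by (rule SyzE)
  then show ?thesis
    using SyzD[OF assms] X
    by (intro SyzI[where \<omega> = "Neg C S (crel X) \<omega>"]) (auto simp: comp_neg_left)
qed

lemma Syz_comp:
  assumes "(S, \<sigma>) \<in> Syz C X" "R \<in> Obj C" "\<rho> \<in> Hom C R S"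
  shows "(R, Comp C R S (cobj X) \<rho> \<sigma>) \<in> Syz C X"
proof -
  obtain \<omega> where "\<omega> \<in> Hom C S (crel X)"
    "Comp C S (cobj X) (capex X) \<sigma> (cgam X) = Comp C S (crel X) (capex X) \<omega> (crho X)"
    using assms(1) by (rule SyzE)
  then show ?thesis
    using SyzD[OF assms(1)] assms(2,3) X
    by (intro SyzI[where \<omega> = "Comp C R S (crel X) \<rho> \<omega>"]) (auto simp: comp_assoc)
qed

end

text \<open>A witness for being zero is the same thing as a syzygy witness. Well-definedness comes
  for free: if \<alpha> is a syzygy of \<open>Y\<close>, so is every \<sigma> \<cdot>
  \<alpha>.\<close>

lemma zero_ideal_iff:
  assumes "is_cospan C X" "is_cospan C Y"
  shows "\<alpha> \<in> zero_ideal C X Y \<longleftrightarrow> (cobj X, \<alpha>) \<in> Syz C Y"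
proof
  show "(cobj X, \<alpha>) \<in> Syz C Y" if "\<alpha> \<in> zero_ideal C X Y"
    using that assms
    by (auto simp: zero_ideal_def zero_witness_def Hom_aux_cat_iff intro: SyzI)
  show "\<alpha> \<in> zero_ideal C X Y" if \<alpha>: "(cobj X, \<alpha>) \<in> Syz C Y"
  proof -
    have "\<alpha> \<in> Hom (aux_cat C) X Y"
      using SyzD(2)[OF \<alpha>] by (auto simp: Hom_aux_cat_iff intro!: Syz_comp[OF assms(2) \<alpha>] dest: SyzD)
    moreover obtain \<zeta> where "zero_witness C X Y \<alpha> \<zeta>"
      using SyzE[OF \<alpha>] unfolding zero_witness_def by metis
    ultimately show ?thesis
      by (auto simp: zero_ideal_def)
  qed
qed

lemma comp_aux_closed:
  assumes "is_cospan C X" "is_cospan C Y" "is_cospan C Z"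
    and f: "f \<in> Hom (aux_cat C) X Y" and g: "g \<in> Hom (aux_cat C) Y Z"
  shows "Comp C (cobj X) (cobj Y) (cobj Z) f g \<in> Hom (aux_cat C) X Z"
  unfolding Hom_aux_cat_iff
proof (intro conjI allI impI)
  note fg = Hom_aux_catD(1)[OF f] Hom_aux_catD(1)[OF g]
  show "Comp C (cobj X) (cobj Y) (cobj Z) f g \<in> Hom C (cobj X) (cobj Z)"
    using fg assms by simp
  fix S \<sigma> assume \<sigma>: "(S, \<sigma>) \<in> Syz C X"
  then show "(S, Comp C S (cobj X) (cobj Z) \<sigma> (Comp C (cobj X) (cobj Y) (cobj Z) f g)) \<in> Syz C Z"
    using Hom_aux_catD(2)[OF g Hom_aux_catD(2)[OF f \<sigma>]] SyzD[OF \<sigma>] fg assms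
    by (simp add: comp_assoc)
qed

text \<open>Syzygies are closed under sums and negatives, so the well-defined morphisms form a
  subgroup of each hom group, and the equational laws are inherited from \<open>C\<close>. By
  \<open>zero_ideal_iff\<close> the ideal laws are closure laws of syzygies: the right one is
  well-definedness of the second factor, the left one is \<open>Syz_comp\<close>.\<close>

lemma aux_ideal: "preadditive_ideal (aux_cat C) (zero_ideal C)"
proof -
  have sub: "subgroup (Hom (aux_cat C) X Y) (hom_group C (cobj X) (cobj Y))"
    if "is_cospan C X" "is_cospan C Y" for X Y
  proof (rule group.subgroupI)
    show "group (hom_group C (cobj X) (cobj Y))"
      using that by (simp add: hom_comm_group comm_group.axioms(2))
    have "Null C (cobj X) (cobj Y) \<in> Hom (aux_cat C) X Y"
      using that by (auto simp: Hom_aux_cat_iff SyzD Syz_null)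
    then show "Hom (aux_cat C) X Y \<noteq> {}" by auto
  qed (use that in \<open>auto simp: Hom_aux_cat_iff comp_plus_left comp_plus_right comp_neg_right
        SyzD Syz_plus Syz_neg simp flip: Neg_def\<close>)
  have hom_group_eq: "hom_group (aux_cat C) X Y
      = (hom_group C (cobj X) (cobj Y))\<lparr>carrier := Hom (aux_cat C) X Y\<rparr>" for X Y
    by (simp add: hom_group_def)
  show ?thesis
  proof (intro preadditive_ideal.intro preadditive_category.intro category.intro
      preadditive_category_axioms.intro preadditive_ideal_axioms.intro)
    fix X Y assume XY: "X \<in> Obj (aux_cat C)" "Y \<in> Obj (aux_cat C)"
    then interpret hom: comm_group "hom_group C (cobj X) (cobj Y)"
      using hom_comm_group by simp
    show grp: "comm_group (hom_group (aux_cat C) X Y)"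
      using group.group_comm_groupI[OF hom.subgroup_imp_group[OF sub]] XY
      by (auto simp: hom_group_eq Hom_aux_cat_iff plus_commute)
    show "subgroup (zero_ideal C X Y) (hom_group (aux_cat C) X Y)"
    proof (rule group.subgroupI)
      show "group (hom_group (aux_cat C) X Y)"
        using grp comm_group.axioms(2) by blast
      show "zero_ideal C X Y \<subseteq> carrier (hom_group (aux_cat C) X Y)"
        by (auto simp: zero_ideal_def)
      have "Null C (cobj X) (cobj Y) \<in> zero_ideal C X Y"
        using XY by (simp add: zero_ideal_iff Syz_null)
      then show "zero_ideal C X Y \<noteq> {}" by auto
    next
      fix f assume f: "f \<in> zero_ideal C X Y"
      \<comment> \<open>Inverses in a subgroup are those of the ambient group, which brings
        \<open>Syz_neg\<close> into play.\<close>
      have "inv\<^bsub>hom_group (aux_cat C) X Y\<^esub> f = Neg C (cobj X) (cobj Y) f"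
        using hom.m_inv_consistent[OF sub[of X Y], of f] f XY
        by (auto simp: hom_group_eq Neg_def zero_ideal_def)
      then show "inv\<^bsub>hom_group (aux_cat C) X Y\<^esub> f \<in> zero_ideal C X Y"
        using f XY by (simp add: zero_ideal_iff Syz_neg)
    qed (use XY in \<open>auto simp: zero_ideal_iff Syz_plus\<close>)
  next
    fix X assume "X \<in> Obj (aux_cat C)"
    then show "Ident (aux_cat C) X \<in> Hom (aux_cat C) X X"
      by (auto simp: Hom_aux_cat_iff SyzD)
  next
    fix X Y Z f g
    assume "X \<in> Obj (aux_cat C)" "Y \<in> Obj (aux_cat C)" "Z \<in> Obj (aux_cat C)"
      and "f \<in> Hom (aux_cat C) X Y" "g \<in> Hom (aux_cat C) Y Z"
    then show "Comp (aux_cat C) X Y Z f g \<in> Hom (aux_cat C) X Z"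
      using comp_aux_closed by simp
  next
    fix X Y Z f g
    assume "X \<in> Obj (aux_cat C)" "Y \<in> Obj (aux_cat C)" "Z \<in> Obj (aux_cat C)"
      and "f \<in> zero_ideal C X Y" "g \<in> Hom (aux_cat C) Y Z"
    then show "Comp (aux_cat C) X Y Z f g \<in> zero_ideal C X Z"
      using Hom_aux_catD(2)[of g C Y Z "cobj X" f] by (simp add: zero_ideal_iff)
  next
    fix X Y Z f g
    assume "X \<in> Obj (aux_cat C)" "Y \<in> Obj (aux_cat C)" "Z \<in> Obj (aux_cat C)"
      and "f \<in> Hom (aux_cat C) X Y" "g \<in> zero_ideal C Y Z"
    then show "Comp (aux_cat C) X Y Z f g \<in> zero_ideal C X Z"
      using Syz_comp[of Z "cobj Y" g "cobj X" f] Hom_aux_catD(1)[of f C X Y]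
      by (simp add: zero_ideal_iff)
  qed (auto simp: comp_plus_left comp_plus_right comp_assoc dest!: Hom_aux_catD(1))
qed


end

section \<open>Monomorphisms and their cokernels\<close>

context additive_category
begin

interpretation aux: preadditive_ideal "aux_cat C" "zero_ideal C"
  by (rule aux_ideal)

section \<open>Equality and composition of classes in the quotient\<close>

lemma Q_class_closed:
  "\<alpha> \<in> Hom (aux_cat C) X Y \<Longrightarrow> Q_class C X Y \<alpha> \<in> Hom (Q_cat C) X Y"
  by (auto simp: Q_cat_def Q_class_def aux.Hom_quotient)

lemma Hom_Q_catE:
  assumes "F \<in> Hom (Q_cat C) X Y"
  obtains f where "f \<in> Hom (aux_cat C) X Y" "F = Q_class C X Y f"
  using assms by (auto simp: Q_cat_def Q_class_def aux.Hom_quotient)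

lemma Q_sel [simp]:
  "Obj (Q_cat C) = {X. is_cospan C X}"
  "Null (Q_cat C) X Y = zero_ideal C X Y"
  by (simp_all add: Q_cat_def)

lemma comp_Q_class:
  assumes "is_cospan C X" "is_cospan C Y" "is_cospan C Z"
    "f \<in> Hom (aux_cat C) X Y" "g \<in> Hom (aux_cat C) Y Z"
  shows "Comp (Q_cat C) X Y Z (Q_class C X Y f) (Q_class C Y Z g)
    = Q_class C X Z (Comp C (cobj X) (cobj Y) (cobj Z) f g)"
  using aux.comp_mor_class[of X Y Z f g] assms by (simp add: Q_cat_def Q_class_def)

text \<open>Both categories share \<open>Plus\<close> and \<open>Null\<close>, and negatives are
  unique in the larger hom group.\<close>

lemma Neg_aux_cat:
  assumes "is_cospan C X" "is_cospan C Y" "f \<in> Hom (aux_cat C) X Y"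
  shows "Neg (aux_cat C) X Y f = Neg C (cobj X) (cobj Y) f"
  using assms aux.plus_neg(2)[of X Y f] aux.neg_closed[of X Y f]
  by (simp add: eq_neg_iff Hom_aux_cat_iff)

text \<open>The bridge from the quotient to syzygies: equations between classes become membership of
  a difference, with no cosets left.\<close>

lemma Q_class_eq_iff:
  assumes "is_cospan C X" "is_cospan C Y" "f \<in> Hom (aux_cat C) X Y" "g \<in> Hom (aux_cat C) X Y"
  shows "Q_class C X Y f = Q_class C X Y g
    \<longleftrightarrow> (cobj X, Plus C (cobj X) (cobj Y) f (Neg C (cobj X) (cobj Y) g)) \<in> Syz C Y"
  using assms aux.mor_class_eq_iff[of X Y f g]
  by (simp add: Q_class_def zero_ideal_iff Neg_aux_cat)

lemma Q_class_eq_zero_iff: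
  assumes "is_cospan C X" "is_cospan C Y" "f \<in> Hom (aux_cat C) X Y"
  shows "Q_class C X Y f = zero_ideal C X Y \<longleftrightarrow> (cobj X, f) \<in> Syz C Y"
  using assms aux.mor_class_eq_ideal_iff[of X Y f] by (simp add: Q_class_def zero_ideal_iff)

section \<open>Morphisms into and out of a direct sum\<close>

lemma to_sum_closed:
  assumes "is_direct_sum C X1 X2 D" "T \<in> Obj C" "z1 \<in> Hom C T X1" "z2 \<in> Hom C T X2"
  shows "to_sum C X1 X2 D T z1 z2 \<in> Hom C T (dsum D)"
  using assms by (auto simp: to_sum_def is_direct_sum_def)

lemma from_sum_closed:
  assumes "is_direct_sum C X1 X2 D" "Y \<in> Obj C" "r1 \<in> Hom C X1 Y" "r2 \<in> Hom C X2 Y"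
  shows "from_sum C X1 X2 D Y r1 r2 \<in> Hom C (dsum D) Y"
  using assms by (auto simp: from_sum_def is_direct_sum_def)

text \<open>Here \<omega> is arbitrary and need not be presented as a row; this is what splits an
  unknown witness into its two components.\<close>

lemma comp_from_sum:
  assumes D: "is_direct_sum C X1 X2 D"
    and "T \<in> Obj C" "Y \<in> Obj C" "\<omega> \<in> Hom C T (dsum D)" "r1 \<in> Hom C X1 Y" "r2 \<in> Hom C X2 Y"
  shows "Comp C T (dsum D) Y \<omega> (from_sum C X1 X2 D Y r1 r2)
    = Plus C T Y (Comp C T X1 Y (Comp C T (dsum D) X1 \<omega> (prj1 D)) r1)
        (Comp C T X2 Y (Comp C T (dsum D) X2 \<omega> (prj2 D)) r2)"
  using assms by (auto simp: from_sum_def is_direct_sum_def comp_plus_right comp_assoc)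

lemma to_sum_prj:
  assumes "is_direct_sum C X1 X2 D" "T \<in> Obj C" "z1 \<in> Hom C T X1" "z2 \<in> Hom C T X2"
  shows "Comp C T (dsum D) X1 (to_sum C X1 X2 D T z1 z2) (prj1 D) = z1"
    and "Comp C T (dsum D) X2 (to_sum C X1 X2 D T z1 z2) (prj2 D) = z2"
  using assms by (auto simp: to_sum_def is_direct_sum_def comp_plus_left comp_assoc)

lemma to_sum_from_sum:
  assumes "is_direct_sum C X1 X2 D" "T \<in> Obj C" "Y \<in> Obj C"
    "z1 \<in> Hom C T X1" "z2 \<in> Hom C T X2" "r1 \<in> Hom C X1 Y" "r2 \<in> Hom C X2 Y"
  shows "Comp C T (dsum D) Y (to_sum C X1 X2 D T z1 z2) (from_sum C X1 X2 D Y r1 r2)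
    = Plus C T Y (Comp C T X1 Y z1 r1) (Comp C T X2 Y z2 r2)"
  using assms by (simp add: comp_from_sum to_sum_closed to_sum_prj)

text \<open>
  The only syzygy of the cospan formed by the identity of \<open>S\<close> and the zero map into \<open>S\<close> is zero, so every
  morphism out of \<open>S\<close> is well defined on it and can be tested against the monomorphism.
\<close>

lemma mono_reflects_Syz:
  assumes "is_cospan C A" "is_cospan C B" "\<alpha> \<in> Hom (aux_cat C) A B"
    and mono: "is_mono (Q_cat C) A B (Q_class C A B \<alpha>)"
    and \<sigma>: "S \<in> Obj C" "\<sigma> \<in> Hom C S (cobj A)"
      "(S, Comp C S (cobj A) (cobj B) \<sigma> \<alpha>) \<in> Syz C B"
  shows "(S, \<sigma>) \<in> Syz C A"
proof -
  define W where "W = \<lparr>cobj = S, capex = S, crel = S, cgam = Ident C S, crho = Null C S S\<rparr>"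
  have W: "is_cospan C W" "cobj W = S"
    using \<sigma>(1) by (auto simp: W_def is_cospan_def)
  have Syz_W: "\<rho> = Null C R S" if "(R, \<rho>) \<in> Syz C W" for R \<rho>
    using that \<sigma>(1) by (auto simp: Syz_def W_def)
  have mem: "\<sigma>' \<in> Hom (aux_cat C) W Y" if "\<sigma>' \<in> Hom C S (cobj Y)" "is_cospan C Y" for \<sigma>' Y
    unfolding Hom_aux_cat_iff
  proof (intro conjI allI impI)
    show "\<sigma>' \<in> Hom C (cobj W) (cobj Y)" using that W by simp
    fix R \<rho> assume "(R, \<rho>) \<in> Syz C W"
    then show "(R, Comp C R (cobj W) (cobj Y) \<rho> \<sigma>') \<in> Syz C Y"
      using Syz_W[of R \<rho>] SyzD(1)[of R \<rho> C W] that W(2) \<sigma>(1) by (simp add: Syz_null)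
  qed
  let ?z = "Null C S (cobj A)"
  have z: "\<sigma> \<in> Hom (aux_cat C) W A" "?z \<in> Hom (aux_cat C) W A"
    using mem \<sigma> assms(1) by auto
  \<comment> \<open>The two composites agree because \<sigma> \<cdot> \<alpha> - 0 is a syzygy of
    \<open>B\<close> by assumption. After cancelling, the same translation makes \<sigma> - 0 a
    syzygy of \<open>A\<close>.\<close>
  have "Comp (Q_cat C) W A B (Q_class C W A \<sigma>) (Q_class C A B \<alpha>)
      = Comp (Q_cat C) W A B (Q_class C W A ?z) (Q_class C A B \<alpha>)"
    using z W \<sigma> assms(1-3) mem[of _ B] Hom_aux_catD(1)[OF assms(3)]
    by (simp add: comp_Q_class Q_class_eq_iff)
  then have "Q_class C W A \<sigma> = Q_class C W A ?z"
    using mono z W(1) Q_class_closed unfolding is_mono_def by simp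
  then show ?thesis
    using z W \<sigma> assms(1) by (simp add: Q_class_eq_iff)
qed

section \<open>Lifting along a monomorphism\<close>

context
  fixes A B \<alpha>
  assumes A: "is_cospan C A" and B: "is_cospan C B"
    and \<alpha>: "\<alpha> \<in> Hom (aux_cat C) A B"
begin

lemma \<alpha>_hom [simp]: "\<alpha> \<in> Hom C (cobj A) (cobj B)"
  using \<alpha> by (rule Hom_aux_catD)

text \<open>Subtracting \<zeta>2 \<cdot> \<alpha> removes the second summand, so \<zeta>1 is itself
  the syzygy witness of the difference.\<close>

lemma diff_SyzI:
  assumes "T \<in> Obj C" "\<tau> \<in> Hom C T (cobj B)" "\<zeta>1 \<in> Hom C T (crel B)" "\<zeta>2 \<in> Hom C T (cobj A)"
    and "Comp C T (cobj B) (capex B) \<tau> (cgam B)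
      = Plus C T (capex B) (Comp C T (crel B) (capex B) \<zeta>1 (crho B))
          (Comp C T (cobj A) (capex B) \<zeta>2 (Comp C (cobj A) (cobj B) (capex B) \<alpha> (cgam B)))"
  shows "(T, Plus C T (cobj B) \<tau> (Neg C T (cobj B) (Comp C T (cobj A) (cobj B) \<zeta>2 \<alpha>))) \<in> Syz C B"
  using assms A B
  by (intro SyzI[where \<omega> = \<zeta>1])
    (auto simp: comp_plus_left comp_neg_left comp_assoc plus_diff_cancel)

text \<open>Stated for a difference that is a syzygy, so that it serves both a prescribed witness
  and a \<zeta> obtained from \<open>Syz_coker_iff\<close>.\<close>

lemma lift_along_mono:
  assumes mono: "is_mono (Q_cat C) A B (Q_class C A B \<alpha>)"
    and T: "is_cospan C T" and \<tau>: "\<tau> \<in> Hom (aux_cat C) T B"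
    and \<zeta>: "\<zeta> \<in> Hom C (cobj T) (cobj A)"
    and diff: "(cobj T, Plus C (cobj T) (cobj B) \<tau>
      (Neg C (cobj T) (cobj B) (Comp C (cobj T) (cobj A) (cobj B) \<zeta> \<alpha>))) \<in> Syz C B"
  shows "\<zeta> \<in> Hom (aux_cat C) T A"
    and "Comp (Q_cat C) T A B (Q_class C T A \<zeta>) (Q_class C A B \<alpha>) = Q_class C T B \<tau>"
proof -
  note [simp] = Hom_aux_catD(1)[OF \<tau>]
  let ?\<zeta>\<alpha> = "Comp C (cobj T) (cobj A) (cobj B) \<zeta> \<alpha>"
  \<comment> \<open>The sign is reversed so that adding \<sigma> \<cdot> \<tau> below leaves
    \<sigma> \<cdot> \<zeta> \<cdot> \<alpha>.\<close>
  have diff': "(cobj T, Plus C (cobj T) (cobj B) ?\<zeta>\<alpha> (Neg C (cobj T) (cobj B) \<tau>)) \<in> Syz C B"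
    using Syz_neg[OF B diff] A B T \<zeta> by (simp add: neg_diff)
  show \<zeta>_aux: "\<zeta> \<in> Hom (aux_cat C) T A"
    unfolding Hom_aux_cat_iff
  proof (intro conjI allI impI)
    fix S \<sigma> assume syz: "(S, \<sigma>) \<in> Syz C T"
    note S = SyzD[OF syz]
    \<comment> \<open>The first summand is a precomposed syzygy, the second is one because \<tau> is
      well defined.\<close>
    have "(S, Plus C S (cobj B)
        (Comp C S (cobj T) (cobj B) \<sigma> (Plus C (cobj T) (cobj B) ?\<zeta>\<alpha> (Neg C (cobj T) (cobj B) \<tau>)))
        (Comp C S (cobj T) (cobj B) \<sigma> \<tau>)) \<in> Syz C B"
      using Syz_plus[OF B] Syz_comp[OF B diff'] S Hom_aux_catD(2)[OF \<tau> syz] by blast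
    also have "Plus C S (cobj B)
        (Comp C S (cobj T) (cobj B) \<sigma> (Plus C (cobj T) (cobj B) ?\<zeta>\<alpha> (Neg C (cobj T) (cobj B) \<tau>)))
        (Comp C S (cobj T) (cobj B) \<sigma> \<tau>)
      = Comp C S (cobj A) (cobj B) (Comp C S (cobj T) (cobj A) \<sigma> \<zeta>) \<alpha>"
      using S A B T \<zeta> by (simp add: diff_plus_cancel comp_assoc flip: comp_plus_right)
    finally show "(S, Comp C S (cobj T) (cobj A) \<sigma> \<zeta>) \<in> Syz C A"
      using mono_reflects_Syz[OF A B \<alpha> mono] S A T \<zeta> by simp
  qed (rule \<zeta>)
  have "?\<zeta>\<alpha> \<in> Hom (aux_cat C) T B"
    using comp_aux_closed \<zeta>_aux A B T \<alpha> by blast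
  then show "Comp (Q_cat C) T A B (Q_class C T A \<zeta>) (Q_class C A B \<alpha>) = Q_class C T B \<tau>"
    using diff' \<tau> \<zeta>_aux A B T \<alpha> by (simp add: comp_Q_class Q_class_eq_iff)
qed

section \<open>The cokernel object and its universal property\<close>

context
  fixes D K
  assumes D: "is_direct_sum C (crel B) (cobj A) D"
    and K_def: "K = coker_cospan C A B \<alpha> D"
begin

lemma K_sel [simp]: "cobj K = cobj B" "capex K = capex B" "crel K = dsum D" "cgam K = cgam B"
  by (simp_all add: K_def coker_cospan_def)

lemma K_cospan: "is_cospan C K"
proof -
  have "crho K \<in> Hom C (dsum D) (capex B)"
    using A B by (auto simp: K_def coker_cospan_def intro!: from_sum_closed[OF D])
  moreover have "dsum D \<in> Obj C"
    using D by (simp add: is_direct_sum_def)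
  ultimately show ?thesis
    using B unfolding is_cospan_def K_sel by blast
qed

text \<open>A witness into the direct sum has two components: the one into \<open>cobj A\<close>
  becomes \<omega>, the one into \<open>crel B\<close> becomes the witness of the difference. The
  universal property can then be checked without computing in \<open>D\<close>.\<close>

lemma Syz_coker_iff:
  "(S, \<sigma>) \<in> Syz C K \<longleftrightarrow> S \<in> Obj C \<and> \<sigma> \<in> Hom C S (cobj B) \<and>
    (\<exists>\<omega>\<in>Hom C S (cobj A).
      (S, Plus C S (cobj B) \<sigma> (Neg C S (cobj B) (Comp C S (cobj A) (cobj B) \<omega> \<alpha>))) \<in> Syz C B)"
    (is "?L \<longleftrightarrow> ?R")
proof
  assume L: ?L
  then have S: "S \<in> Obj C" "\<sigma> \<in> Hom C S (cobj B)"
    using SyzD[OF L] by auto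
  from L obtain \<omega> where \<omega>: "\<omega> \<in> Hom C S (dsum D)"
    "Comp C S (cobj B) (capex B) \<sigma> (cgam B) = Comp C S (dsum D) (capex B) \<omega> (crho K)"
    by (auto elim: SyzE)
  have "prj1 D \<in> Hom C (dsum D) (crel B)" "prj2 D \<in> Hom C (dsum D) (cobj A)" "dsum D \<in> Obj C"
    using D by (auto simp: is_direct_sum_def)
  then show ?R
    using S \<omega> A B D
      diff_SyzI[of S \<sigma> "Comp C S (dsum D) (crel B) \<omega> (prj1 D)" "Comp C S (dsum D) (cobj A) \<omega> (prj2 D)"]
    by (auto simp: K_def coker_cospan_def comp_from_sum intro!: bexI)
next
  assume R: ?R
  then obtain \<omega>2 where S: "S \<in> Obj C" "\<sigma> \<in> Hom C S (cobj B)" and \<omega>2: "\<omega>2 \<in> Hom C S (cobj A)"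
    and syz: "(S, Plus C S (cobj B) \<sigma> (Neg C S (cobj B) (Comp C S (cobj A) (cobj B) \<omega>2 \<alpha>))) \<in> Syz C B"
    by blast
  let ?d = "Plus C S (cobj B) \<sigma> (Neg C S (cobj B) (Comp C S (cobj A) (cobj B) \<omega>2 \<alpha>))"
  obtain \<omega>1 where \<omega>1: "\<omega>1 \<in> Hom C S (crel B)"
    "Comp C S (cobj B) (capex B) ?d (cgam B) = Comp C S (crel B) (capex B) \<omega>1 (crho B)"
    using syz by (rule SyzE)
  \<comment> \<open>Composing this decomposition with \<open>cgam B\<close> gives one summand for
    each entry of the column \<open>crho K\<close>, so the row of \<omega>1 and \<omega>2 is a
    witness.\<close>
  have "\<sigma> = Plus C S (cobj B) ?d (Comp C S (cobj A) (cobj B) \<omega>2 \<alpha>)"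
    using S \<omega>2 A B by (simp add: diff_plus_cancel)
  then have "Comp C S (cobj B) (capex B) \<sigma> (cgam B)
      = Plus C S (capex B) (Comp C S (cobj B) (capex B) ?d (cgam B))
          (Comp C S (cobj B) (capex B) (Comp C S (cobj A) (cobj B) \<omega>2 \<alpha>) (cgam B))"
    using comp_plus_left[of S "cobj B" "capex B" ?d "Comp C S (cobj A) (cobj B) \<omega>2 \<alpha>" "cgam B"]
      S \<omega>2 A B by simp
  also have "\<dots> = Comp C S (dsum D) (capex B)
      (to_sum C (crel B) (cobj A) D S \<omega>1 \<omega>2) (crho K)"
    using S \<omega>1 \<omega>2 A B D
    by (simp add: K_def coker_cospan_def to_sum_from_sum comp_assoc)
  finally show ?L
    using S \<omega>1 \<omega>2 to_sum_closed[OF D]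
    by (intro SyzI[where \<omega> = "to_sum C (crel B) (cobj A) D S \<omega>1 \<omega>2"]) auto
qed

text \<open>The choice \<omega> = 0 suffices. Hence arrows that are well defined into
  \<open>B\<close> stay so into \<open>K\<close>, and those well defined out of \<open>K\<close> are
  so out of \<open>B\<close>.\<close>

lemma Syz_subset_coker: "(S, \<sigma>) \<in> Syz C B \<Longrightarrow> (S, \<sigma>) \<in> Syz C K"
  using A B SyzD[of S \<sigma> C B]
  by (auto simp: Syz_coker_iff intro!: bexI[where x = "Null C S (cobj A)"])

lemma coker_projection_closed: "Ident C (cobj B) \<in> Hom (aux_cat C) B K"
  using B by (auto simp: Hom_aux_cat_iff SyzD Syz_subset_coker)

lemma aux_coker_closed: "\<tau> \<in> Hom (aux_cat C) T B \<Longrightarrow> \<tau> \<in> Hom (aux_cat C) T K"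
  by (auto simp: Hom_aux_cat_iff Syz_subset_coker)

text \<open>The projection is represented by an identity, so the representative stays and only the
  codomain of the class changes.\<close>

lemma comp_projection:
  assumes "is_cospan C T" "\<tau> \<in> Hom (aux_cat C) T B"
  shows "Comp (Q_cat C) T B K (Q_class C T B \<tau>) (Q_class C B K (Ident C (cobj B))) = Q_class C T K \<tau>"
  using assms B K_cospan coker_projection_closed Hom_aux_catD(1)[OF assms(2)]
  by (simp add: comp_Q_class)

lemma projection_comp:
  assumes "is_cospan C T" "u \<in> Hom (aux_cat C) K T"
  shows "Comp (Q_cat C) B K T (Q_class C B K (Ident C (cobj B))) (Q_class C K T u) = Q_class C B T u"
  using assms B K_cospan coker_projection_closed Hom_aux_catD(1)[OF assms(2)]
  by (simp add: comp_Q_class)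

text \<open>A syzygy of \<open>K\<close> is d + \<omega> \<cdot> \<alpha> with d a syzygy of
  \<open>B\<close>. After composing with \<open>t\<close>, the first term is a syzygy because
  \<open>t\<close> is well defined on \<open>B\<close>, the second because \<alpha> \<cdot> t is
  one.\<close>

lemma coker_descent:
  assumes T: "is_cospan C T" and t: "t \<in> Hom (aux_cat C) B T"
    and zero: "(cobj A, Comp C (cobj A) (cobj B) (cobj T) \<alpha> t) \<in> Syz C T"
  shows "t \<in> Hom (aux_cat C) K T"
  unfolding Hom_aux_cat_iff
proof (intro conjI allI impI)
  note [simp] = Hom_aux_catD(1)[OF t]
  show "t \<in> Hom C (cobj K) (cobj T)" by simp
  fix S \<sigma> assume "(S, \<sigma>) \<in> Syz C K"
  then obtain \<omega> where S: "S \<in> Obj C" "\<sigma> \<in> Hom C S (cobj B)" and \<omega>: "\<omega> \<in> Hom C S (cobj A)"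
    and syz: "(S, Plus C S (cobj B) \<sigma> (Neg C S (cobj B) (Comp C S (cobj A) (cobj B) \<omega> \<alpha>))) \<in> Syz C B"
    by (auto simp: Syz_coker_iff)
  let ?d = "Plus C S (cobj B) \<sigma> (Neg C S (cobj B) (Comp C S (cobj A) (cobj B) \<omega> \<alpha>))"
  have "(S, Plus C S (cobj T) (Comp C S (cobj B) (cobj T) ?d t)
      (Comp C S (cobj A) (cobj T) \<omega> (Comp C (cobj A) (cobj B) (cobj T) \<alpha> t))) \<in> Syz C T"
    using Syz_plus Syz_comp T Hom_aux_catD(2)[OF t syz] zero S \<omega> by blast
  also have "Plus C S (cobj T) (Comp C S (cobj B) (cobj T) ?d t)
      (Comp C S (cobj A) (cobj T) \<omega> (Comp C (cobj A) (cobj B) (cobj T) \<alpha> t))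
    = Comp C S (cobj B) (cobj T) (Plus C S (cobj B) ?d (Comp C S (cobj A) (cobj B) \<omega> \<alpha>)) t"
    using S \<omega> A B T by (simp add: comp_plus_left comp_assoc)
  also have "Plus C S (cobj B) ?d (Comp C S (cobj A) (cobj B) \<omega> \<alpha>) = \<sigma>"
    using S \<omega> A B by (simp add: diff_plus_cancel)
  finally show "(S, Comp C S (cobj K) (cobj T) \<sigma> t) \<in> Syz C T" by simp
qed

lemma is_cokernel_coker:
  "is_cokernel (Q_cat C) A B (Q_class C A B \<alpha>) K (Q_class C B K (Ident C (cobj B)))"
proof -
  let ?p = "Q_class C B K (Ident C (cobj B))"
  \<comment> \<open>With \<omega> the identity of \<open>cobj A\<close>, the difference \<alpha> -
    \<omega> \<cdot> \<alpha> is zero.\<close>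
  have "(cobj A, \<alpha>) \<in> Syz C K"
    using A B Syz_null[OF B]
    by (auto simp: Syz_coker_iff intro!: bexI[where x = "Ident C (cobj A)"])
  then have "Comp (Q_cat C) A B K (Q_class C A B \<alpha>) ?p = zero_ideal C A K"
    using A \<alpha> K_cospan by (simp add: comp_projection aux_coker_closed Q_class_eq_zero_iff)
  moreover have "\<exists>!u. u \<in> Hom (Q_cat C) K T \<and> Comp (Q_cat C) B K T ?p u = t"
    if T: "is_cospan C T" "t \<in> Hom (Q_cat C) B T"
      and zero: "Comp (Q_cat C) A B T (Q_class C A B \<alpha>) t = zero_ideal C A T" for T t
  proof -
    obtain t' where t': "t' \<in> Hom (aux_cat C) B T" "t = Q_class C B T t'"
      using T(2) by (rule Hom_Q_catE)
    have "Comp C (cobj A) (cobj B) (cobj T) \<alpha> t' \<in> Hom (aux_cat C) A T"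
      using comp_aux_closed A B T \<alpha> t' by blast
    \<comment> \<open>The factorization is represented by the same arrow, now read as starting at
      \<open>K\<close>.\<close>
    then have t'K: "t' \<in> Hom (aux_cat C) K T"
      using coker_descent[OF T(1) t'(1)] zero A B T \<alpha> t'
      by (simp add: comp_Q_class Q_class_eq_zero_iff)
    show ?thesis
    proof (rule ex1I[where a = "Q_class C K T t'"], intro conjI)
      show "Q_class C K T t' \<in> Hom (Q_cat C) K T"
        using t'K by (rule Q_class_closed)
      show "Comp (Q_cat C) B K T ?p (Q_class C K T t') = t"
        using T(1) t'K t'(2) by (simp add: projection_comp)
    next
      fix v assume v: "v \<in> Hom (Q_cat C) K T \<and> Comp (Q_cat C) B K T ?p v = t"
      then obtain v' where v': "v' \<in> Hom (aux_cat C) K T" "v = Q_class C K T v'"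
        by (auto elim: Hom_Q_catE)
      \<comment> \<open>Equality of classes involves the domain only through its
        \<open>cobj\<close>, which \<open>B\<close> and \<open>K\<close> share; so agreement of
        \<open>v'\<close> and \<open>t'\<close> on \<open>B\<close> is agreement on
        \<open>K\<close>.\<close>
      have "v' \<in> Hom (aux_cat C) B T"
        using v'(1) Syz_subset_coker by (auto simp: Hom_aux_cat_iff)
      then show "v = Q_class C K T t'"
        using v v' t' t'K T(1) B K_cospan by (simp add: projection_comp Q_class_eq_iff)
    qed
  qed
  ultimately show ?thesis
    using A B K_cospan Q_class_closed[OF \<alpha>] Q_class_closed[OF coker_projection_closed]
    by (simp add: is_cokernel_def)
qed

lemma zero_witness_to_sum:
  assumes "is_cospan C T" "\<tau> \<in> Hom (aux_cat C) T B"
    "\<zeta>1 \<in> Hom C (cobj T) (crel B)" "\<zeta>2 \<in> Hom C (cobj T) (cobj A)"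
    "zero_witness C T K (Comp C (cobj T) (cobj B) (cobj B) \<tau> (Ident C (cobj B)))
      (to_sum C (crel B) (cobj A) D (cobj T) \<zeta>1 \<zeta>2)"
  shows "Comp C (cobj T) (cobj B) (capex B) \<tau> (cgam B)
    = Plus C (cobj T) (capex B) (Comp C (cobj T) (crel B) (capex B) \<zeta>1 (crho B))
        (Comp C (cobj T) (cobj A) (capex B) \<zeta>2 (Comp C (cobj A) (cobj B) (capex B) \<alpha> (cgam B)))"
  using assms A B D Hom_aux_catD(1)[OF assms(2)]
  by (simp add: zero_witness_def K_def coker_cospan_def to_sum_from_sum)

lemma mono_is_kernel:
  assumes mono: "is_mono (Q_cat C) A B (Q_class C A B \<alpha>)"
    and coker: "is_cokernel (Q_cat C) A B (Q_class C A B \<alpha>) Z c"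
  shows "is_kernel (Q_cat C) B Z c A (Q_class C A B \<alpha>)"
proof (rule aux.mono_is_kernel_of_cokernel[folded Q_cat_def, OF mono is_cokernel_coker _ coker])
  fix T t
  assume "T \<in> Obj (aux_cat C)" and t: "t \<in> Hom (Q_cat C) T B"
    and zero: "Comp (Q_cat C) T B K t (Q_class C B K (Ident C (cobj B))) = zero_ideal C T K"
  then have T: "is_cospan C T" by simp
  obtain \<tau> where \<tau>: "\<tau> \<in> Hom (aux_cat C) T B" "t = Q_class C T B \<tau>"
    using t by (rule Hom_Q_catE)
  \<comment> \<open>Being killed by the projection means being a syzygy of \<open>K\<close>, and
    \<open>Syz_coker_iff\<close> turns this into the \<zeta> to be lifted.\<close>
  have "(cobj T, \<tau>) \<in> Syz C K"
    using zero T \<tau> K_cospan by (simp add: comp_projection aux_coker_closed Q_class_eq_zero_iff)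
  then show "\<exists>u\<in>Hom (Q_cat C) T A. Comp (Q_cat C) T A B u (Q_class C A B \<alpha>) = t"
    using lift_along_mono[OF mono T \<tau>(1)] \<tau>(2) Q_class_closed unfolding Syz_coker_iff by blast
qed

end

end

end

text \<open>The last conjunct concerns every cokernel of an arbitrary monomorphism, not only the
  constructed one; existence of a cokernel is asserted separately so that the kernel claim is not
  vacuous.\<close>

theorem mainTheorem7:
  fixes P :: "('o, 'm, 'z) preadd_cat_scheme"
  assumes additive: "additive_category P"
  shows
    "(\<forall>A B \<alpha> D K.
        A \<in> Obj (aux_cat P) \<and> B \<in> Obj (aux_cat P) \<and> \<alpha> \<in> Hom (aux_cat P) A B \<and>
        is_mono (Q_cat P) A B (Q_class P A B \<alpha>) \<and>
        is_direct_sum P (crel B) (cobj A) D \<and> K = coker_cospan P A B \<alpha> D \<longrightarrow>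
          is_cokernel (Q_cat P) A B (Q_class P A B \<alpha>) K (Q_class P B K (Ident P (cobj B))) \<and>
          (\<forall>T \<tau> \<zeta>1 \<zeta>2.
            T \<in> Obj (aux_cat P) \<and> \<tau> \<in> Hom (aux_cat P) T B \<and>
            Comp (Q_cat P) T B K (Q_class P T B \<tau>) (Q_class P B K (Ident P (cobj B)))
              = Null (Q_cat P) T K \<and>
            \<zeta>1 \<in> Hom P (cobj T) (crel B) \<and> \<zeta>2 \<in> Hom P (cobj T) (cobj A) \<and>
            zero_witness P T K (Comp (aux_cat P) T B K \<tau> (Ident P (cobj B)))
              (to_sum P (crel B) (cobj A) D (cobj T) \<zeta>1 \<zeta>2) \<longrightarrow>
              Comp P (cobj T) (cobj B) (capex B) \<tau> (cgam B)
                = Plus P (cobj T) (capex B)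
                    (Comp P (cobj T) (crel B) (capex B) \<zeta>1 (crho B))
                    (Comp P (cobj T) (cobj A) (capex B) \<zeta>2
                      (Comp P (cobj A) (cobj B) (capex B) \<alpha> (cgam B))) \<and>
              \<zeta>2 \<in> Hom (aux_cat P) T A \<and>
              Q_class P T A \<zeta>2 \<in> Hom (Q_cat P) T A \<and>
              Comp (Q_cat P) T A B (Q_class P T A \<zeta>2) (Q_class P A B \<alpha>) = Q_class P T B \<tau>)) \<and>
     (\<forall>X Y f. is_mono (Q_cat P) X Y f \<longrightarrow>
        (\<exists>Z c. is_cokernel (Q_cat P) X Y f Z c) \<and>
        (\<forall>Z c. is_cokernel (Q_cat P) X Y f Z c \<longrightarrow> is_kernel (Q_cat P) Y Z c X f))"

proof (intro conjI allI impI)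
  interpret additive_category P by (rule additive)
  {
    fix A B \<alpha> D K
    assume "A \<in> Obj (aux_cat P) \<and> B \<in> Obj (aux_cat P) \<and> \<alpha> \<in> Hom (aux_cat P) A B \<and>
      is_mono (Q_cat P) A B (Q_class P A B \<alpha>) \<and>
      is_direct_sum P (crel B) (cobj A) D \<and> K = coker_cospan P A B \<alpha> D"
    then have A: "is_cospan P A" and B: "is_cospan P B" and \<alpha>: "\<alpha> \<in> Hom (aux_cat P) A B"
      and mono: "is_mono (Q_cat P) A B (Q_class P A B \<alpha>)"
      and D: "is_direct_sum P (crel B) (cobj A) D" and K: "K = coker_cospan P A B \<alpha> D"
      by simp_all
    show "is_cokernel (Q_cat P) A B (Q_class P A B \<alpha>) K (Q_class P B K (Ident P (cobj B)))"
      using is_cokernel_coker[OF A B \<alpha> D K] .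
    fix T \<tau> \<zeta>1 \<zeta>2
    assume "T \<in> Obj (aux_cat P) \<and> \<tau> \<in> Hom (aux_cat P) T B \<and>
      Comp (Q_cat P) T B K (Q_class P T B \<tau>) (Q_class P B K (Ident P (cobj B)))
        = Null (Q_cat P) T K \<and>
      \<zeta>1 \<in> Hom P (cobj T) (crel B) \<and> \<zeta>2 \<in> Hom P (cobj T) (cobj A) \<and>
      zero_witness P T K (Comp (aux_cat P) T B K \<tau> (Ident P (cobj B)))
        (to_sum P (crel B) (cobj A) D (cobj T) \<zeta>1 \<zeta>2)"
    then have T: "is_cospan P T" and \<tau>: "\<tau> \<in> Hom (aux_cat P) T B"
      and \<zeta>: "\<zeta>1 \<in> Hom P (cobj T) (crel B)" "\<zeta>2 \<in> Hom P (cobj T) (cobj A)"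
      and wit: "zero_witness P T K (Comp (aux_cat P) T B K \<tau> (Ident P (cobj B)))
        (to_sum P (crel B) (cobj A) D (cobj T) \<zeta>1 \<zeta>2)"
      by simp_all
    show eq: "Comp P (cobj T) (cobj B) (capex B) \<tau> (cgam B)
        = Plus P (cobj T) (capex B)
            (Comp P (cobj T) (crel B) (capex B) \<zeta>1 (crho B))
            (Comp P (cobj T) (cobj A) (capex B) \<zeta>2
              (Comp P (cobj A) (cobj B) (capex B) \<alpha> (cgam B)))"
      using zero_witness_to_sum[OF A B \<alpha> D K T \<tau> \<zeta>] wit by (simp add: K coker_cospan_def)
    \<comment> \<open>From here on \<zeta>1 is absorbed into the syzygy, and only \<zeta>2 is
      lifted.\<close>
    note diff = diff_SyzI[OF A B \<alpha> is_cospanD(1)[OF T] Hom_aux_catD(1)[OF \<tau>] \<zeta> eq]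
    show \<zeta>2: "\<zeta>2 \<in> Hom (aux_cat P) T A"
      using lift_along_mono(1)[OF A B \<alpha> mono T \<tau> \<zeta>(2) diff] .
    show "Q_class P T A \<zeta>2 \<in> Hom (Q_cat P) T A"
      using \<zeta>2 by (rule Q_class_closed)
    show "Comp (Q_cat P) T A B (Q_class P T A \<zeta>2) (Q_class P A B \<alpha>) = Q_class P T B \<tau>"
      using lift_along_mono(2)[OF A B \<alpha> mono T \<tau> \<zeta>(2) diff] .
  }
  fix X Y f assume mono: "is_mono (Q_cat P) X Y f"
  then have X: "is_cospan P X" and Y: "is_cospan P Y" and "f \<in> Hom (Q_cat P) X Y"
    by (auto simp: is_mono_def)
  then obtain \<alpha> where \<alpha>: "\<alpha> \<in> Hom (aux_cat P) X Y" "f = Q_class P X Y \<alpha>"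
    by (auto elim: Hom_Q_catE)
  \<comment> \<open>Additivity of \<open>P\<close> provides the direct sum on which the cokernel
    object of a representative of \<open>f\<close> is built.\<close>
  obtain D where D: "is_direct_sum P (crel Y) (cobj X) D"
    using ex_direct_sum X Y by (meson is_cospanD)
  show "\<exists>Z c. is_cokernel (Q_cat P) X Y f Z c"
    using is_cokernel_coker[OF X Y \<alpha>(1) D refl] \<alpha>(2) by blast
  show "is_kernel (Q_cat P) Y Z c X f" if "is_cokernel (Q_cat P) X Y f Z c" for Z c
    using mono_is_kernel[OF X Y \<alpha>(1) D refl] mono \<alpha>(2) that by simp
qed

end
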